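(* For every $n\geqslant 1$, $$Q_n(x,y,z,p,q,r,s,t)=t^{n}\sum_{i+2j+3k=2n+1}\gamma_{n,i,j,k}\left(\frac{x+y+z}{t}\right)^i\left(\frac{xyp+xzq+yzr}{t}\right)^j\left(\frac{xyzpqrs}{t}\right)^{k},$$ the sum over nonnegative integers $i,j,k$.
   Context: A Stirling permutation of order $n$ is a word $\sigma=\sigma_1\cdots\sigma_{2n}$ on the multiset $\{1,1,2,2,\ldots,n,n\}$ such that whenever $\sigma_i=\sigma_j$ with $i<j$, $\sigma_s>\sigma_i$ for all $i<s<j$; $\mathcal{Q}_n$ is the set of these. Convention: $\sigma_0=\sigma_{2n+1}=0$. Each statistic below counts the values $v\in[n]$ with the stated property (positions $i<j$ denote the two occurrences of $v$ where relevant): $\mathrm{asc}$: $v=\sigma_i$ with $\sigma_{i-1}<\sigma_i$; $\mathrm{plat}$: $v=\sigma_i$ with $\sigma_i=\sigma_{i+1}$; $\mathrm{des}$: $v=\sigma_i$ with $\sigma_i>\sigma_{i+1}$; $\mathrm{lap}$: $v=\sigma_i$ with $\sigma_{i-1}<\sigma_i=\sigma_{i+1}$; $\mathrm{rpd}$: $v=\sigma_i$ with $\sigma_{i-1}=\sigma_i>\sigma_{i+1}$; $\mathrm{eud}$: $\sigma_{i-1}<\sigma_i$ and $\sigma_j>\sigma_{j+1}$; $\mathrm{apd}$: $v=\sigma_i$ with $\sigma_{i-1}<\sigma_i=\sigma_{i+1}>\sigma_{i+2}$; $\mathrm{vv}$: both occurrences are valleys, $\sigma_{i-1}>\sigma_i<\sigma_{i+1}$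 and $\sigma_{j-1}>\sigma_j<\sigma_{j+1}$. Define $Q_n(x,y,z,p,q,r,s,t)=\sum_{\sigma\in\mathcal{Q}_n}x^{\mathrm{asc}(\sigma)}y^{\mathrm{plat}(\sigma)}z^{\mathrm{des}(\sigma)}p^{\mathrm{lap}(\sigma)}q^{\mathrm{eud}(\sigma)}r^{\mathrm{rpd}(\sigma)}s^{\mathrm{apd}(\sigma)}t^{\mathrm{vv}(\sigma)}$. The integers $\gamma_{n,i,j,k}$ ($n\geqslant1$; $i,j,k\geqslant0$) are defined by $\gamma_{1,0,0,1}=1$, $\gamma_{1,i,j,k}=0$ otherwise, and for $n\geqslant2$: $\gamma_{n,i,j,k}=3(i+1)\gamma_{n-1,i+1,j,k-1}+2(j+1)\gamma_{n-1,i-1,j+1,k-1}+k\gamma_{n-1,i,j-1,k}$, where terms with a negative index are $0$. (They are the coefficients in $\sum_{\sigma\in\mathcal{Q}_n}x^{\mathrm{asc}}y^{\mathrm{plat}}z^{\mathrm{des}}=\sum_{i+2j+3k=2n+1}\gamma_{n,i,j,k}(x+y+z)^i(xy+yz+zx)^j(xyz)^k$.) *)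

theory Defs
  imports Complex_Main "HOL-Library.Multiset"
begin

text \<open>
  Words are lists of natural numbers. Positions are 1-based and a word is bordered by \<open>0\<close>:
  \<open>letter w i\<close> is \<open>\<sigma>\<^sub>i\<close> for \<open>1 \<le> i \<le> 2n\<close>, and \<open>\<sigma>\<^sub>0 = \<sigma>\<^sub>2\<^sub>n\<^sub>+\<^sub>1 = 0\<close>.
\<close>

definition letter :: "nat list \<Rightarrow> nat \<Rightarrow> nat" where
  "letter w i = (if 1 \<le> i \<and> i \<le> length w then w ! (i - 1) else 0)"

definition stirling_perms :: "nat \<Rightarrow> nat list set" where
  "stirling_perms n = {w.
     mset w = mset_set {1..n} + mset_set {1..n} \<and>
     (\<forall>i j k. 1 \<le> i \<and> i < k \<and> k < j \<and> j \<le> 2 * n \<and> letter w i = letter w j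
        \<longrightarrow> letter w k > letter w i)}"

text \<open>
  Each statistic counts values \<open>v \<in> {1..n}\<close>. Since the border letter is \<open>0\<close>, neighbours lying
  outside \<open>{1..2n}\<close> never have a positive value.
\<close>

definition asc :: "nat \<Rightarrow> nat list \<Rightarrow> nat" where
  "asc n w = card {v \<in> {1..n}. \<exists>i \<in> {1..2*n}. v = letter w i \<and>
     letter w (i - 1) < letter w i}"

definition plat :: "nat \<Rightarrow> nat list \<Rightarrow> nat" where
  "plat n w = card {v \<in> {1..n}. \<exists>i \<in> {1..2*n}. v = letter w i \<and>
     letter w i = letter w (i + 1)}"

definition des :: "nat \<Rightarrow> nat list \<Rightarrow> nat" where
  "des n w = card {v \<in> {1..n}. \<exists>i \<in> {1..2*n}. v = letter w i \<and>
     letter w i > letter w (i + 1)}"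

definition lap :: "nat \<Rightarrow> nat list \<Rightarrow> nat" where
  "lap n w = card {v \<in> {1..n}. \<exists>i \<in> {1..2*n}. v = letter w i \<and>
     letter w (i - 1) < letter w i \<and> letter w i = letter w (i + 1)}"

definition rpd :: "nat \<Rightarrow> nat list \<Rightarrow> nat" where
  "rpd n w = card {v \<in> {1..n}. \<exists>i \<in> {1..2*n}. v = letter w i \<and>
     letter w (i - 1) = letter w i \<and> letter w i > letter w (i + 1)}"

definition eud :: "nat \<Rightarrow> nat list \<Rightarrow> nat" where
  "eud n w = card {v \<in> {1..n}. \<exists>i \<in> {1..2*n}. \<exists>j \<in> {1..2*n}. i < j \<and>
     v = letter w i \<and> v = letter w j \<and>
     letter w (i - 1) < letter w i \<and> letter w j > letter w (j + 1)}"

definition apd :: "nat \<Rightarrow> nat list \<Rightarrow> nat" where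
  "apd n w = card {v \<in> {1..n}. \<exists>i \<in> {1..2*n}. v = letter w i \<and>
     letter w (i - 1) < letter w i \<and> letter w i = letter w (i + 1) \<and>
     letter w (i + 1) > letter w (i + 2)}"

definition valley :: "nat list \<Rightarrow> nat \<Rightarrow> bool" where
  "valley w i \<longleftrightarrow> letter w (i - 1) > letter w i \<and> letter w i < letter w (i + 1)"

definition vv :: "nat \<Rightarrow> nat list \<Rightarrow> nat" where
  "vv n w = card {v \<in> {1..n}. \<exists>i \<in> {1..2*n}. \<exists>j \<in> {1..2*n}. i < j \<and>
     v = letter w i \<and> v = letter w j \<and> valley w i \<and> valley w j}"

definition Q_poly :: "nat \<Rightarrow> 'a \<Rightarrow> 'a \<Rightarrow> 'a \<Rightarrow> 'a \<Rightarrow> 'a \<Rightarrow> 'a \<Rightarrow> 'a \<Rightarrow> 'a \<Rightarrow> 'a::comm_ring_1" where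
  "Q_poly n x y z p q r s t = (\<Sum>w \<in> stirling_perms n.
     x ^ asc n w * y ^ plat n w * z ^ des n w * p ^ lap n w *
     q ^ eud n w * r ^ rpd n w * s ^ apd n w * t ^ vv n w)"

text \<open>
  The numbers \<open>\<gamma>\<^sub>n\<^sub>,\<^sub>i\<^sub>,\<^sub>j\<^sub>,\<^sub>k\<close>; the case distinctions drop the terms with a negative index.
  They are only meaningful for \<open>n \<ge> 1\<close>; the value at \<open>n = 0\<close> is a dummy.
\<close>

fun gamma :: "nat \<Rightarrow> nat \<Rightarrow> nat \<Rightarrow> nat \<Rightarrow> int" where
  "gamma 0 i j k = 0"
| "gamma (Suc 0) i j k = (if i = 0 \<and> j = 0 \<and> k = 1 then 1 else 0)"
| "gamma (Suc (Suc n)) i j k =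
     (if k = 0 then 0 else 3 * (int i + 1) * gamma (Suc n) (i + 1) j (k - 1)) +
     (if i = 0 \<or> k = 0 then 0 else 2 * (int j + 1) * gamma (Suc n) (i - 1) (j + 1) (k - 1)) +
     (if j = 0 then 0 else int k * gamma (Suc n) i (j - 1) k)"

lemma finite_stirling_perms: "finite (stirling_perms n)"
proof (rule finite_subset)
  show "stirling_perms n \<subseteq> {w. mset w = mset_set {1..n} + mset_set {1..n}}"
    by (auto simp: stirling_perms_def)
  show "finite {w. mset w = mset_set {1..n} + mset_set {1..n}}"
    by (metis (mono_tags) ex_mset mset_eq_finite)
qed

lemma finite_gamma_indices: "finite {(i, j, k). i + 2 * j + 3 * k = 2 * n + (1::nat)}"
  by (rule finite_subset[of _ "{..2*n+1} \<times> {..2*n+1} \<times> {..2*n+1}"]) auto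

end

theory Submission
  imports Defs "HOL-Library.Sublist"
begin

text \<open>
  Read \<open>0 w 0\<close> as a sequence of \<open>2n + 1\<close> steps and attach each step to its larger letter: it is a
  rise, a level or a fall of that letter, each kind occurring at most once per letter. All eight
  statistics depend only on the sets of kinds attached to the letters, so \<open>Q\<^sub>n\<close> is a sum of products of
  weights of these sets: with \<open>I = x + y + z\<close> for one kind, \<open>J = xyp + xzq + yzr\<close> for two,
  \<open>K = xyzpqrs\<close> for three, and \<open>t\<close> for none. Inserting the pair \<open>(n+1)(n+1)\<close> into a step removes
  this step and creates a letter with all three kinds. On polynomials in the weights this is a
  derivation with \<open>K \<mapsto> J K\<close>, \<open>J \<mapsto> 2 I K\<close>, \<open>I \<mapsto> 3 t K\<close>, \<open>t \<mapsto> 0\<close>, and applying it to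
  \<open>I\<^sup>i J\<^sup>j K\<^sup>k t\<^sup>m\<close> gives the recurrence of \<open>\<gamma>\<close>. Since the weights are elements of a field and not
  indeterminates, the derivation is represented by its dual operator \<open>grow\<close> on functions of
  multisets of step sets, and its values on \<open>I\<close>, \<open>J\<close>, \<open>K\<close> become commutation relations.
\<close>

section \<open>Insertion of the two largest letters\<close>

lemma letter_conv_nth:
  "g \<le> length w \<Longrightarrow> letter w g = (0 # w) ! g"
  "g \<le> length w \<Longrightarrow> letter w (Suc g) = (w @ [0]) ! g"
  by (auto simp: letter_def nth_append nth_Cons split: nat.splits)

lemma length_stirling_perms: "w \<in> stirling_perms n \<Longrightarrow> length w = 2 * n"
proof -
  assume "w \<in> stirling_perms n"
  then have "mset w = mset_set {1..n} + mset_set {1..n}"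
    by (simp add: stirling_perms_def)
  then have "size (mset w) = size (mset_set {1..n} + mset_set {1..n})" by (rule arg_cong)
  then show ?thesis by simp
qed

lemma set_stirling_perms: "w \<in> stirling_perms n \<Longrightarrow> set w = {1..n}"
proof -
  assume "w \<in> stirling_perms n"
  then have "mset w = mset_set {1..n} + mset_set {1..n}"
    by (simp add: stirling_perms_def)
  then have "set_mset (mset w) = {1..n}" by simp
  then show ?thesis by simp
qed

lemma subseq3_iff:
  "subseq [a, b, c] w \<longleftrightarrow>
    (\<exists>i k j. i < k \<and> k < j \<and> j < length w \<and> w ! i = a \<and> w ! k = b \<and> w ! j = c)"
  (is "?L \<longleftrightarrow> ?R")
proof
  assume ?L
  then obtain w1 w2 w3 w4 where w: "w = w1 @ a # w2 @ b # w3 @ c # w4"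
    by (auto dest!: list_emb_ConsD)
  show ?R
    by (rule exI[of _ "length w1"], rule exI[of _ "length w1 + Suc (length w2)"],
        rule exI[of _ "length w1 + Suc (length w2) + Suc (length w3)"])
      (simp add: w nth_append)
next
  assume ?R
  then obtain i k j where h: "i < k" "k < j" "j < length w" "w ! i = a" "w ! k = b" "w ! j = c"
    by blast
  have "subseq [w ! i, w ! k, w ! j] w"
  proof -
    have "w ! j \<in> set (drop (Suc k) w)"
      using h by (auto simp: in_set_conv_nth intro!: exI[of _ "j - Suc k"])
    then have "subseq [w ! k, w ! j] (w ! k # drop (Suc k) w)"
      by (simp add: subseq_singleton_left)
    then have "subseq [w ! k, w ! j] (take (k - Suc i) (drop (Suc i) w) @ w ! k # drop (Suc k) w)"
      by (rule subseq_drop_many)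
    also have "\<dots> = drop (Suc i) w"
      using h id_take_nth_drop[of "k - Suc i" "drop (Suc i) w"] by simp
    finally have "subseq [w ! i, w ! k, w ! j] (w ! i # drop (Suc i) w)"
      by simp
    then have "subseq [w ! i, w ! k, w ! j] (take i w @ w ! i # drop (Suc i) w)"
      by (rule subseq_drop_many)
    also have "\<dots> = w"
      using h by (intro id_take_nth_drop[symmetric]) simp
    finally show ?thesis .
  qed
  then show ?L using h by simp
qed

text \<open>A condition on positions becomes one on patterns: every subsequence
  \<open>[v, u, v]\<close> has \<open>v < u\<close>. In this form it passes to subsequences, and
  \<open>filter\<close> and append handle deletion and insertion without index arithmetic.\<close>

lemma stirling_perms_subseq:
  "stirling_perms n = {w. mset w = mset_set {1..n} + mset_set {1..n} \<and>
     (\<forall>v u. subseq [v, u, v] w \<longrightarrow> v < u)}"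
proof -
  have "(\<forall>i j k. 1 \<le> i \<and> i < k \<and> k < j \<and> j \<le> 2 * n \<and> letter w i = letter w j
        \<longrightarrow> letter w k > letter w i) \<longleftrightarrow> (\<forall>v u. subseq [v, u, v] w \<longrightarrow> v < u)"
    (is "?L \<longleftrightarrow> ?R")
    if w: "mset w = mset_set {1..n} + mset_set {1..n}" for w
  proof -
    have len: "length w = 2 * n"
      using arg_cong[OF w, of size] by simp
    have nth: "letter w (Suc i) = w ! i" if "i < length w" for i
      using that by (simp add: letter_def)
    show ?thesis
    proof
      assume L: ?L
      show ?R
      proof (intro allI impI)
        fix v u assume "subseq [v, u, v] w"
        then obtain i k j where h: "i < k" "k < j" "j < length w" "w ! i = v" "w ! k = u" "w ! j = v"
          unfolding subseq3_iff by blast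
        then show "v < u"
          using L[rule_format, of "Suc i" "Suc k" "Suc j"] len nth[of i] nth[of j] nth[of k] by simp
      qed
    next
      assume R: ?R
      show ?L
      proof (intro allI impI)
        fix i j k
        assume "1 \<le> i \<and> i < k \<and> k < j \<and> j \<le> 2 * n \<and> letter w i = letter w j"
        then have "subseq [letter w i, letter w k, letter w i] w"
          using len unfolding subseq3_iff
          by (intro exI[of _ "i - 1"] exI[of _ "k - 1"] exI[of _ "j - 1"]) (auto simp: letter_def)
        then show "letter w i < letter w k" using R by blast
      qed
    qed
  qed
  then show ?thesis unfolding stirling_perms_def by blast
qed

lemma mset_twice_Suc:
  "mset_set {1..Suc n} + mset_set {1..Suc n} =
    add_mset (Suc n) (add_mset (Suc n) (mset_set {1..n} + mset_set {1..n}))"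
  by (simp add: atLeastAtMostSuc_conv)

text \<open>Let \<open>N = Suc n\<close>. A pattern \<open>N x N\<close> would need a third
  \<open>N\<close> behind the two adjacent copies; a pattern \<open>v N v\<close> is harmless as
  \<open>v \<le> n\<close>; any other pattern survives deletion of \<open>N\<close> and so lies in
  the old word.\<close>

lemma stirling_perms_insert:
  assumes "u @ u' \<in> stirling_perms n"
  shows "u @ Suc n # Suc n # u' \<in> stirling_perms (Suc n)"
proof -
  let ?N = "Suc n" and ?w = "u @ Suc n # Suc n # u'"
  have m: "mset (u @ u') = mset_set {1..n} + mset_set {1..n}"
    and sub: "\<And>v x. subseq [v, x, v] (u @ u') \<Longrightarrow> v < x"
    using assms by (auto simp: stirling_perms_subseq)
  have st: "set u \<union> set u' = {1..n}" using set_stirling_perms[OF assms] by simp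
  have "?N \<notin> set u \<union> set u'" unfolding st by simp
  then have notin: "?N \<notin> set u" "?N \<notin> set u'" by auto
  have "filter (\<lambda>x. x \<noteq> ?N) u = u" "filter (\<lambda>x. x \<noteq> ?N) u' = u'"
    using notin by (auto simp: filter_id_conv)
  then have fil: "filter (\<lambda>x. x \<noteq> ?N) ?w = u @ u'"
    by simp
  have skip: "subseq (a # as) (xs @ ys) \<Longrightarrow> a \<notin> set xs \<Longrightarrow> subseq (a # as) ys"
    for a :: nat and as xs ys
    by (induction xs) auto
  have "v < x" if h: "subseq [v, x, v] ?w" for v x
  proof (cases "v = ?N")
    case True
    have "subseq [?N, x, ?N] (?N # ?N # u')"
      using skip[OF h[unfolded True] notin(1)] .
    then have "subseq [x, ?N] u' \<or> subseq [?N] u'"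
      by (auto split: if_splits)
    then have "?N \<in> set u'"
      using list_emb_set[of "(=)" "[x, ?N]" u' ?N] list_emb_set[of "(=)" "[?N]" u' ?N] by auto
    then show ?thesis using notin by blast
  next
    case False
    have "v \<in> set ?w" "x \<in> set ?w"
      using list_emb_set[OF h, of v] list_emb_set[OF h, of x] by auto
    then have "v \<le> n" using st False by auto
    show ?thesis
    proof (cases "x = ?N")
      case True then show ?thesis using \<open>v \<le> n\<close> by simp
    next
      case x: False
      have "subseq (filter (\<lambda>x. x \<noteq> ?N) [v, x, v]) (filter (\<lambda>x. x \<noteq> ?N) ?w)"
        using h by (rule subseq_filter)
      then show ?thesis using sub fil False x by simp
    qed
  qed
  moreover have "mset ?w = mset_set {1..?N} + mset_set {1..?N}"
    unfolding mset_twice_Suc m[symmetric] by simp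
  ultimately show ?thesis by (auto simp: stirling_perms_subseq)
qed

text \<open>A letter between the two copies of the maximum would have to exceed the maximum, so the
  copies are adjacent; deleting them leaves a subsequence.\<close>

lemma stirling_perms_SucE:
  assumes "w \<in> stirling_perms (Suc n)"
  obtains u u' where "w = u @ Suc n # Suc n # u'" "u @ u' \<in> stirling_perms n"
proof -
  let ?N = "Suc n"
  have m: "mset w = mset_set {1..?N} + mset_set {1..?N}"
    and sub: "\<And>v x. subseq [v, x, v] w \<Longrightarrow> v < x"
    using assms by (auto simp: stirling_perms_subseq)
  have st: "set w = {1..?N}" using set_stirling_perms[OF assms] .
  then obtain u r where u: "w = u @ ?N # r"
    by (metis Suc_leI atLeastAtMost_iff in_set_conv_decomp le_refl zero_less_Suc One_nat_def)
  have c: "count (mset w) ?N = 2" unfolding m by simp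
  \<comment> \<open>The occurrence split off above may be either of the two, so the other one is
    sought on both sides.\<close>
  have "\<exists>a b d. w = a @ ?N # b @ ?N # d"
  proof (cases "?N \<in> set r")
    case True
    then obtain b d where "r = b @ ?N # d" by (auto dest: split_list)
    then show ?thesis using u by blast
  next
    case False
    then have "count (mset r) ?N = 0" by (simp add: count_eq_zero_iff)
    then have "count (mset u) ?N \<noteq> 0" using c unfolding u by (simp del: count_mset_0_iff)
    then have "?N \<in> set u" by simp
    then obtain a b where "u = a @ ?N # b" by (auto dest: split_list)
    then show ?thesis using u by auto
  qed
  then obtain a b d where w: "w = a @ ?N # b @ ?N # d" by blast
  have "b = []"
  proof (rule ccontr)
    assume "b \<noteq> []"
    then obtain x b' where b: "b = x # b'" by (cases b) auto
    have "subseq [?N, x, ?N] w"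
      unfolding w b by (intro subseq_drop_many) (simp add: subseq_drop_many)
    then have "?N < x" using sub by blast
    moreover have "x \<in> set w" unfolding w b by simp
    ultimately show False using st by auto
  qed
  then have w: "w = a @ ?N # ?N # d" using w by simp
  have "mset (a @ d) = mset_set {1..n} + mset_set {1..n}"
    using m unfolding mset_twice_Suc w by simp
  moreover have "subseq (a @ d) w"
    unfolding w by (intro list_emb_append_mono subseq_order.order_refl list_emb_Cons)
  ultimately have "a @ d \<in> stirling_perms n"
    using sub by (auto simp: stirling_perms_subseq dest: subseq_order.trans)
  then show thesis using that w by blast
qed

text \<open>Pairs of a word of order \<open>n\<close> and one of its \<open>2n + 1\<close> gaps
  correspond bijectively to words of order \<open>Suc n\<close>.\<close>

lemma sum_stirling_perms_Suc:
  "(\<Sum>w\<in>stirling_perms (Suc n). f w) =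
    (\<Sum>w\<in>stirling_perms n. \<Sum>g\<le>2 * n. f (take g w @ Suc n # Suc n # drop g w))"
proof -
  let ?ins = "\<lambda>(w, g). take g w @ Suc n # Suc n # drop g w"
  let ?S = "stirling_perms n \<times> {..2 * n}"
  have "(\<Sum>w\<in>stirling_perms n. \<Sum>g\<le>2 * n. f (take g w @ Suc n # Suc n # drop g w)) =
      (\<Sum>wg\<in>?S. f (?ins wg))"
    by (simp add: sum.cartesian_product case_prod_unfold)
  also have "\<dots> = sum f (?ins ` ?S)"
  proof (rule sum.reindex_cong[symmetric, of ?ins])
    have notin: "Suc n \<notin> set (take g w)" "Suc n \<notin> set (drop g w)" if "w \<in> stirling_perms n" for w g
      using set_stirling_perms[OF that] by (auto dest!: in_set_takeD in_set_dropD)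
    show "inj_on ?ins ?S"
    proof (rule inj_onI)
      fix e e' assume "e \<in> ?S" "e' \<in> ?S" "?ins e = ?ins e'"
      then obtain w g w' g' where e: "e = (w, g)" "e' = (w', g')"
        and w: "w \<in> stirling_perms n" "g \<in> {..2 * n}" "w' \<in> stirling_perms n" "g' \<in> {..2 * n}"
        and eq: "take g w @ Suc n # Suc n # drop g w = take g' w' @ Suc n # Suc n # drop g' w'"
        by auto
      \<comment> \<open>The prefix before the first maximum recovers the part of the word left of
        the gap, hence the gap as its length.\<close>
      have "takeWhile (\<lambda>x. x \<noteq> Suc n) (take g w @ Suc n # Suc n # drop g w) = take g w"
        "takeWhile (\<lambda>x. x \<noteq> Suc n) (take g' w' @ Suc n # Suc n # drop g' w') = take g' w'"
        using notin(1)[OF w(1), of g] notin(1)[OF w(3), of g']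
        by (simp_all add: takeWhile_append)
      then have 1: "take g w = take g' w'" using eq by metis
      then have 2: "drop g w = drop g' w'" using eq by simp
      have "w = w'" using 1 2 by (metis append_take_drop_id)
      moreover have "g = g'"
        using arg_cong[OF 1, of length] w length_stirling_perms[of w n] length_stirling_perms[of w' n]
        by simp
      ultimately show "e = e'" unfolding e by blast
    qed
  qed auto
  also have "?ins ` ?S = stirling_perms (Suc n)"
  proof (intro equalityI subsetI)
    fix w assume "w \<in> ?ins ` ?S"
    then show "w \<in> stirling_perms (Suc n)"
      by (auto intro!: stirling_perms_insert)
  next
    fix w assume "w \<in> stirling_perms (Suc n)"
    then obtain u u' where "w = u @ Suc n # Suc n # u'" "u @ u' \<in> stirling_perms n"
      by (rule stirling_perms_SucE)
    then show "w \<in> ?ins ` ?S"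
      using length_stirling_perms[of "u @ u'" n]
      by (intro image_eqI[of _ _ "(u @ u', length u)"]) auto
  qed
  finally show ?thesis ..
qed

section \<open>Steps of a word\<close>

datatype kind = Rise | Level | Fall

lemma UNIV_kind: "UNIV = {Rise, Level, Fall}"
  using kind.exhaust by auto

instance kind :: finite
  by standard (simp add: UNIV_kind)

fun step :: "nat \<Rightarrow> nat \<Rightarrow> nat \<times> kind" where
  "step a c = (if a < c then (c, Rise) else if a = c then (c, Level) else (a, Fall))"

text \<open>The argument \<open>a\<close> is the left neighbour; calling \<open>steps 0 w\<close>
  supplies the left border and the base case the right one. The empty word has the single step
  \<open>(0, Level)\<close>.\<close>

fun steps :: "nat \<Rightarrow> nat list \<Rightarrow> (nat \<times> kind) list" where
  "steps a [] = [step a 0]"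
| "steps a (c # w) = step a c # steps c w"

lemma length_steps [simp]: "length (steps a w) = Suc (length w)"
  by (induction w arbitrary: a) auto

lemma nth_steps: "g \<le> length w \<Longrightarrow> steps a w ! g = step ((a # w) ! g) ((w @ [0]) ! g)"
proof (induction w arbitrary: a g)
  case (Cons c w)
  then show ?case by (cases g) (auto simp del: step.simps)
qed simp

lemma in_set_steps:
  "e \<in> set (steps 0 w) \<longleftrightarrow> (\<exists>g\<le>length w. e = step (letter w g) (letter w (Suc g)))"
  by (auto simp: in_set_conv_nth nth_steps letter_conv_nth less_Suc_eq_le simp del: step.simps)

text \<open>As \<open>N\<close> exceeds both neighbours of the gap, borders included, only the step
  across the gap changes. The equation \<open>length es = length u\<close> identifies that step by
  its index.\<close>

lemma steps_insert:
  assumes "a < N" "\<forall>c\<in>set (u @ u'). c < N"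
  shows "\<exists>es e es'. length es = length u \<and> steps a (u @ u') = es @ e # es' \<and>
    steps a (u @ N # N # u') = es @ (N, Rise) # (N, Level) # (N, Fall) # es'"
  using assms
proof (induction u arbitrary: a)
  case Nil
  then show ?case by (cases u') auto
next
  case (Cons c u)
  have "c < N" "\<forall>c\<in>set (u @ u'). c < N" using Cons.prems by auto
  from Cons.IH[OF this] obtain es e es' where "length es = length u"
    "steps c (u @ u') = es @ e # es'"
    "steps c (u @ N # N # u') = es @ (N, Rise) # (N, Level) # (N, Fall) # es'"
    by blast
  then show ?case
    by (intro exI[of _ "step a c # es"] exI[of _ e] exI[of _ es']) (simp del: step.simps)
qed

text \<open>Distinctness turns removal at index \<open>g\<close> into removal from the set of steps;
  the bound on first components makes the three steps of \<open>Suc n\<close> new.\<close>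

lemma steps_insert_take_drop:
  assumes w: "w \<in> stirling_perms n" and g: "g \<le> 2 * n" and d: "distinct (steps 0 w)"
    and s: "fst ` set (steps 0 w) \<subseteq> {..n}"
  defines "w' \<equiv> take g w @ Suc n # Suc n # drop g w"
  shows "distinct (steps 0 w')"
    and "set (steps 0 w') = set (steps 0 w) - {steps 0 w ! g} \<union> {Suc n} \<times> UNIV"
proof -
  have len: "length (take g w) = g" using length_stirling_perms[OF w] g by simp
  have "\<exists>es e es'. length es = length (take g w) \<and> steps 0 (take g w @ drop g w) = es @ e # es' \<and>
    steps 0 w' = es @ (Suc n, Rise) # (Suc n, Level) # (Suc n, Fall) # es'"
    unfolding w'_def append_take_drop_id[of g w]
    by (rule steps_insert[of 0 "Suc n" "take g w" "drop g w", unfolded append_take_drop_id])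
      (use set_stirling_perms[OF w] in auto)
  then obtain es e es' where e: "length es = g" "steps 0 w = es @ e # es'"
    "steps 0 w' = es @ (Suc n, Rise) # (Suc n, Level) # (Suc n, Fall) # es'"
    unfolding append_take_drop_id len by blast
  have nth: "steps 0 w ! g = e" by (metis e(1,2) nth_append_length)
  have new: "(Suc n, b) \<notin> set es \<union> set es'" for b using s e(2) by fastforce
  have d': "distinct (es @ e # es')" using d e(2) by simp
  then show "set (steps 0 w') = set (steps 0 w) - {steps 0 w ! g} \<union> {Suc n} \<times> UNIV"
    unfolding nth by (auto simp: e(2,3) UNIV_kind)
  show "distinct (steps 0 w')" using d' new by (simp add: e(3))
qed

lemma stirling_perms_0: "stirling_perms 0 = {[]}"
  by (auto simp: stirling_perms_def)

text \<open>Induction along the insertion of the largest pair. Order \<open>0\<close> is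
  exceptional: the only step there belongs to the border letter \<open>0\<close>.\<close>

lemma distinct_fst_steps:
  "w \<in> stirling_perms n \<Longrightarrow>
    distinct (steps 0 w) \<and> fst ` set (steps 0 w) \<subseteq> (if n = 0 then {0} else {1..n})"
proof (induction n arbitrary: w)
  case 0
  then show ?case by (simp add: stirling_perms_0)
next
  case (Suc n)
  obtain u u' where u: "w = u @ Suc n # Suc n # u'" "u @ u' \<in> stirling_perms n"
    using Suc.prems by (rule stirling_perms_SucE)
  let ?v = "u @ u'" and ?g = "length u"
  have IH: "distinct (steps 0 ?v)" "fst ` set (steps 0 ?v) \<subseteq> (if n = 0 then {0} else {1..n})"
    using Suc.IH[OF u(2)] by auto
  have w: "w = take ?g ?v @ Suc n # Suc n # drop ?g ?v" using u(1) by simp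
  have g: "?g \<le> 2 * n" using length_stirling_perms[OF u(2)] by simp
  have s: "fst ` set (steps 0 ?v) \<subseteq> {..n}" using IH(2) by (auto split: if_splits)
  note ins = steps_insert_take_drop[OF u(2) g IH(1) s, folded w]
  have "fst ` set (steps 0 w) \<subseteq> {1..Suc n}"
  proof (cases "n = 0")
    case True
    then have "?v = []" using u(2) by (simp add: stirling_perms_0)
    then show ?thesis using True unfolding ins(2) by auto
  next
    case False
    then show ?thesis using IH(2) unfolding ins(2) by fastforce
  qed
  then show ?case using ins(1) by simp
qed

lemma distinct_steps: "w \<in> stirling_perms n \<Longrightarrow> distinct (steps 0 w)"
  using distinct_fst_steps by blast

lemma fst_steps: "w \<in> stirling_perms n \<Longrightarrow> n \<ge> 1 \<Longrightarrow> fst ` set (steps 0 w) \<subseteq> {1..n}"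
  using distinct_fst_steps[of w n] by auto

text \<open>In the ternary increasing tree of \<open>w\<close>, the steps of \<open>v\<close> are the vacant child positions of \<open>v\<close>.\<close>

definition steps_of :: "nat list \<Rightarrow> nat \<Rightarrow> kind set" where
  "steps_of w v = {b. (v, b) \<in> set (steps 0 w)}"

text \<open>Labels are forgotten, since every statistic merely counts letters by their step sets. As
  a monomial, this is the product of one variable per letter.\<close>

definition profile :: "nat \<Rightarrow> nat list \<Rightarrow> kind set multiset" where
  "profile n w = image_mset (steps_of w) (mset_set {1..n})"

text \<open>If \<open>D\<close> denotes the derivation on monomials, \<open>grow F\<close> is
  \<open>F\<close> composed with \<open>D\<close>. The sum runs over all steps of all letters,
  counted with multiplicity.\<close>

definition grow :: "(kind set multiset \<Rightarrow> 'a::comm_ring_1) \<Rightarrow> kind set multiset \<Rightarrow> 'a" where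
  "grow F m = (\<Sum>T\<in>#m. \<Sum>b\<in>T. F (add_mset UNIV (add_mset (T - {b}) (m - {#T#}))))"

text \<open>Only two step sets are affected: the letter \<open>v\<close> owning the step at the gap
  loses it, and \<open>Suc n\<close> enters with all three kinds.\<close>

lemma profile_insert:
  assumes w: "w \<in> stirling_perms n" and n: "n \<ge> 1" and g: "g \<le> 2 * n"
    and vb: "steps 0 w ! g = (v, b)"
  shows "profile (Suc n) (take g w @ Suc n # Suc n # drop g w) =
    add_mset UNIV (add_mset (steps_of w v - {b}) (profile n w - {#steps_of w v#}))"
proof -
  let ?w = "take g w @ Suc n # Suc n # drop g w"
  have s: "fst ` set (steps 0 w) \<subseteq> {..n}" using fst_steps[OF w n] by auto
  note st = steps_insert_take_drop(2)[OF w g distinct_steps[OF w] s, unfolded vb]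
  have "(v, b) \<in> set (steps 0 w)"
    using vb length_stirling_perms[OF w] g by (metis le_imp_less_Suc length_steps nth_mem)
  then have v: "v \<in> {1..n}" using fst_steps[OF w n] by force
  have top: "steps_of ?w (Suc n) = UNIV" using st s by (auto simp: steps_of_def)
  have self: "steps_of ?w v = steps_of w v - {b}" using st v by (auto simp: steps_of_def)
  have other: "steps_of ?w u = steps_of w u" if "u \<in> {1..n} - {v}" for u
    using that unfolding steps_of_def st by auto
  have split: "mset_set {1..n} = add_mset v (mset_set ({1..n} - {v}))"
    using v by (simp add: mset_set.remove)
  have "image_mset (steps_of ?w) (mset_set ({1..n} - {v})) =
      image_mset (steps_of w) (mset_set ({1..n} - {v}))"
    by (rule image_mset_cong) (use other in auto)
  then have "image_mset (steps_of ?w) (mset_set {1..n}) =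
      add_mset (steps_of w v - {b}) (profile n w - {#steps_of w v#})"
    unfolding profile_def split by (simp add: self)
  then show ?thesis
    by (simp add: profile_def atLeastAtMostSuc_conv top)
qed

lemma sum_profile_Suc:
  assumes "n \<ge> 1"
  shows "(\<Sum>w\<in>stirling_perms (Suc n). F (profile (Suc n) w)) =
    (\<Sum>w\<in>stirling_perms n. grow F (profile n w))"
  unfolding sum_stirling_perms_Suc
proof (rule sum.cong[OF refl])
  fix w assume w: "w \<in> stirling_perms n"
  let ?f = "\<lambda>v b. F (add_mset UNIV (add_mset (steps_of w v - {b}) (profile n w - {#steps_of w v#})))"
  have len: "length (steps 0 w) = Suc (2 * n)" using length_stirling_perms[OF w] by simp
  have "(\<Sum>g\<le>2 * n. F (profile (Suc n) (take g w @ Suc n # Suc n # drop g w))) =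
      (\<Sum>g\<le>2 * n. case_prod ?f (steps 0 w ! g))"
  proof (rule sum.cong[OF refl])
    fix g assume g: "g \<in> {..2 * n}"
    obtain v b where "steps 0 w ! g = (v, b)" by fastforce
    then show "F (profile (Suc n) (take g w @ Suc n # Suc n # drop g w)) =
        case_prod ?f (steps 0 w ! g)"
      using profile_insert[OF w assms, of g v b] g by simp
  qed
  \<comment> \<open>Gaps are traded for steps: the steps are pairwise distinct, so indexing them is
    a bijection.\<close>
  also have "\<dots> = (\<Sum>e\<in>set (steps 0 w). case_prod ?f e)"
  proof (rule sum.reindex_bij_betw)
    show "bij_betw ((!) (steps 0 w)) {..2 * n} (set (steps 0 w))"
      using bij_betw_nth[OF distinct_steps[OF w], of "{..2 * n}"] len
      by (simp add: lessThan_Suc_atMost)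
  qed
  also have "set (steps 0 w) = Sigma {1..n} (steps_of w)"
    using fst_steps[OF w assms] by (force simp: steps_of_def)
  also have "(\<Sum>e\<in>\<dots>. case_prod ?f e) = (\<Sum>v\<in>{1..n}. \<Sum>b\<in>steps_of w v. ?f v b)"
    by (rule sum.Sigma[symmetric]) auto
  also have "\<dots> = grow F (profile n w)"
    by (simp add: grow_def profile_def sum_unfold_sum_mset image_mset.compositionality comp_def)
  finally show "(\<Sum>g\<le>2 * n. F (profile (Suc n) (take g w @ Suc n # Suc n # drop g w))) =
      grow F (profile n w)" .
qed

lemma sum_profile_1:
  "(\<Sum>w\<in>stirling_perms 1. F (profile 1 w)) = F {#UNIV#}"
proof -
  have "steps_of [Suc 0, Suc 0] (Suc 0) = UNIV"
    by (auto simp: steps_of_def UNIV_kind)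
  then show ?thesis
    unfolding One_nat_def sum_stirling_perms_Suc by (simp add: stirling_perms_0 profile_def)
qed

section \<open>Commutation with the growth operator\<close>

text \<open>The Leibniz rule for the product of the variable of \<open>T\<close> with the monomial
  \<open>m\<close>.\<close>

lemma grow_add_mset:
  "grow F (add_mset T m) = grow (\<lambda>m. F (add_mset T m)) m +
    (\<Sum>b\<in>T. F (add_mset UNIV (add_mset (T - {b}) m)))"
proof -
  have "(\<Sum>S\<in>#m. \<Sum>b\<in>S. F (add_mset UNIV (add_mset (S - {b}) (add_mset T m - {#S#})))) =
      (\<Sum>S\<in>#m. \<Sum>b\<in>S. F (add_mset T (add_mset UNIV (add_mset (S - {b}) (m - {#S#})))))"
  proof (rule arg_cong[of _ _ sum_mset], rule image_mset_cong)
    fix S assume "S \<in># m"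
    then have "add_mset T m - {#S#} = add_mset T (m - {#S#})"
      by (cases "S = T") auto
    then show "(\<Sum>b\<in>S. F (add_mset UNIV (add_mset (S - {b}) (add_mset T m - {#S#})))) =
        (\<Sum>b\<in>S. F (add_mset T (add_mset UNIV (add_mset (S - {b}) (m - {#S#})))))"
      by (simp add: add_mset_commute)
  qed
  then show ?thesis by (simp add: grow_def)
qed

lemma grow_add: "grow (\<lambda>m. F m + G m) m = grow F m + grow G m"
  by (simp add: grow_def sum.distrib sum_mset.distrib)

lemma grow_replicate_empty: "grow F (replicate_mset m {}) = 0"
  by (simp add: grow_def)

text \<open>The transpose of multiplication by \<open>I\<close>: \<open>one F\<close> evaluates
  \<open>F\<close> on \<open>I\<close> times a monomial. Likewise \<open>two\<close> belongs to
  \<open>J\<close>, with a set of two kinds named by the missing kind, and \<open>three\<close> to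
  \<open>K\<close>.\<close>

definition one :: "(kind set multiset \<Rightarrow> 'a::comm_ring_1) \<Rightarrow> kind set multiset \<Rightarrow> 'a" where
  "one F m = (\<Sum>b\<in>UNIV. F (add_mset {b} m))"

definition two :: "(kind set multiset \<Rightarrow> 'a::comm_ring_1) \<Rightarrow> kind set multiset \<Rightarrow> 'a" where
  "two F m = (\<Sum>b\<in>UNIV. F (add_mset (- {b}) m))"

definition three :: "(kind set multiset \<Rightarrow> 'a::comm_ring_1) \<Rightarrow> kind set multiset \<Rightarrow> 'a" where
  "three F m = F (add_mset UNIV m)"

lemma sum_UNIV_kind: "(\<Sum>b\<in>UNIV. f b) = f Rise + f Level + f Fall"
  by (simp add: UNIV_kind add.assoc)

text \<open>The derivation sends \<open>I\<close> to \<open>3 t K\<close>: each of the three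
  singletons loses its only step and becomes empty.\<close>

lemma one_grow: "one (grow F) = (\<lambda>m. grow (one F) m + 3 * three F (add_mset {} m))"
  by (rule ext)
    (simp add: one_def[abs_def] three_def grow_add_mset sum_UNIV_kind grow_add)

text \<open>The derivation sends \<open>J\<close> to \<open>2 I K\<close>: each singleton arises
  from exactly two of the two-element sets.\<close>

lemma two_grow: "two (grow F) = (\<lambda>m. grow (two F) m + 2 * one (three F) m)"
proof -
  have c: "- {Rise} = {Level, Fall}" "- {Level} = {Rise, Fall}" "- {Fall} = {Rise, Level}"
    using UNIV_kind by auto
  show ?thesis
    by (rule ext)
      (simp add: one_def[abs_def] two_def[abs_def] three_def[abs_def] grow_add_mset sum_UNIV_kind
        grow_add c insert_Diff_if add_mset_commute[of UNIV] algebra_simps)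
qed

text \<open>The derivation sends \<open>K\<close> to \<open>J K\<close>: the full set loses one
  kind, and a new full set appears.\<close>

lemma three_grow: "three (grow F) = (\<lambda>m. grow (three F) m + two (three F) m)"
  by (rule ext)
    (simp add: two_def three_def[abs_def] grow_add_mset Compl_eq_Diff_UNIV add_mset_commute[of UNIV])

lemma one_linear: "one (\<lambda>m. F m + c * G m) = (\<lambda>m. one F m + c * one G m)"
  by (rule ext) (simp add: one_def sum.distrib sum_distrib_left)

lemma two_linear: "two (\<lambda>m. F m + c * G m) = (\<lambda>m. two F m + c * two G m)"
  by (rule ext) (simp add: two_def sum.distrib sum_distrib_left)

lemma three_linear: "three (\<lambda>m. F m + c * G m) = (\<lambda>m. three F m + c * three G m)"
  by (rule ext) (simp add: three_def)

lemma three_one: "three (one F) = one (three F)"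
  by (rule ext) (simp add: one_def three_def add_mset_commute[of UNIV])

lemma three_two: "three (two F) = two (three F)"
  by (rule ext) (simp add: two_def three_def add_mset_commute[of UNIV])

lemma two_one: "two (one F) = one (two F)"
  by (rule ext) (simp add: one_def two_def sum_UNIV_kind add_mset_commute add_ac)

section \<open>Powers of the multiplication operators\<close>

lemma funpow_commute:
  "(\<And>x. g (f x) = f (g x)) \<Longrightarrow> g ((f ^^ i) x) = (f ^^ i) (g x)"
  by (induction i) auto

lemma funpow_linear:
  fixes f :: "('b \<Rightarrow> 'a::comm_ring_1) \<Rightarrow> 'b \<Rightarrow> 'a"
  assumes "\<And>F c G. f (\<lambda>m. F m + c * G m) = (\<lambda>m. f F m + c * f G m)"
  shows "(f ^^ i) (\<lambda>m. F m + c * G m) = (\<lambda>m. (f ^^ i) F m + c * (f ^^ i) G m)"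
  by (induction i) (simp_all add: assms)

text \<open>The power rule for a derivation in transposed form: \<open>f\<close> is multiplication
  by an element whose derivative is given by \<open>c\<close> and \<open>h\<close>. For
  \<open>i = 0\<close> the truncated exponent \<open>i - 1\<close> meets a zero coefficient.\<close>

lemma funpow_grow:
  assumes comm: "\<And>F. f (grow F) = (\<lambda>m. grow (f F) m + c * h F m)"
    and h: "\<And>F. h (f F) = f (h F)"
    and lin: "\<And>F c G. f (\<lambda>m. F m + c * G m) = (\<lambda>m. f F m + c * f G m)"
  shows "(f ^^ i) (grow F) =
    (\<lambda>m. grow ((f ^^ i) F) m + of_nat i * c * h ((f ^^ (i - 1)) F) m)"
proof (induction i)
  case (Suc i)
  have "(f ^^ Suc i) (grow F) = f (\<lambda>m. grow ((f ^^ i) F) m + of_nat i * c * h ((f ^^ (i - 1)) F) m)"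
    by (simp add: Suc.IH)
  also have "\<dots> = (\<lambda>m. grow (f ((f ^^ i) F)) m + c * h ((f ^^ i) F) m +
      of_nat i * c * h (f ((f ^^ (i - 1)) F)) m)"
    unfolding lin comm h ..
  also have "\<dots> = (\<lambda>m. grow ((f ^^ Suc i) F) m + of_nat (Suc i) * c * h ((f ^^ (Suc i - 1)) F) m)"
    by (cases i) (simp_all add: algebra_simps)
  finally show ?case .
qed simp

text \<open>Reading a functional \<open>F\<close> on multisets of step sets as a linear functional on polynomials in
  variables indexed by step sets, this is its value on \<open>I\<^sup>i J\<^sup>j K\<^sup>k t\<^sup>m\<close>, where \<open>I\<close>, \<open>J\<close>, \<open>K\<close>
  sum the variables of the step sets of size \<open>1\<close>, \<open>2\<close>, \<open>3\<close>, and \<open>t\<close> belongs to the empty set.\<close>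

definition eval_monom ::
  "nat \<Rightarrow> nat \<Rightarrow> nat \<Rightarrow> nat \<Rightarrow> (kind set multiset \<Rightarrow> 'a::comm_ring_1) \<Rightarrow> 'a" where
  "eval_monom i j k m F = (one ^^ i) ((two ^^ j) ((three ^^ k) F)) (replicate_mset m {})"

text \<open>The product rule on \<open>I\<close>, \<open>J\<close>, \<open>K\<close> and
  \<open>t\<close>, where the powers of \<open>t\<close> contribute nothing. The operator
  \<open>grow\<close> is moved outwards through the powers of \<open>three\<close>,
  \<open>two\<close> and \<open>one\<close> in turn, each passage leaving one extra term.\<close>

lemma eval_monom_grow:
  "eval_monom i j k m (grow F) =
    of_nat k * eval_monom i (j + 1) k m F +
    2 * of_nat j * eval_monom (i + 1) (j - 1) (k + 1) m F +
    3 * of_nat i * eval_monom (i - 1) j (k + 1) (m + 1) F"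
proof -
  define F1 where "F1 = (three ^^ k) F"
  define F2 where "F2 = (two ^^ j) F1"
  have "(three ^^ k) (grow F) =
      (\<lambda>m. grow F1 m + of_nat k * 1 * two (three ((three ^^ (k - 1)) F)) m)"
    unfolding F1_def by (rule funpow_grow) (simp_all add: three_grow three_two three_linear)
  then have 1: "(three ^^ k) (grow F) = (\<lambda>m. grow F1 m + of_nat k * two F1 m)"
    by (cases k) (simp_all add: F1_def)
  have "(two ^^ j) (grow F1) =
      (\<lambda>m. grow F2 m + of_nat j * 2 * one (three ((two ^^ (j - 1)) F1)) m)"
    unfolding F2_def by (rule funpow_grow) (simp_all add: two_grow three_two two_one two_linear)
  then have 2: "(two ^^ j) ((three ^^ k) (grow F)) =
      (\<lambda>m. grow F2 m + of_nat j * 2 * one (three ((two ^^ (j - 1)) F1)) m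
        + of_nat k * (two ^^ j) (two F1) m)"
    unfolding 1 funpow_linear[OF two_linear] by simp
  \<comment> \<open>Here \<open>h\<close> also adds an empty set, which raises the exponent of
    \<open>t\<close> by one.\<close>
  have 3: "(one ^^ i) (grow F2) = (\<lambda>m. grow ((one ^^ i) F2) m +
      of_nat i * 3 * (\<lambda>m. three ((one ^^ (i - 1)) F2) (add_mset {} m)) m)"
    by (rule funpow_grow)
      (simp_all add: one_grow three_one one_linear, simp add: one_def add_mset_commute)
  have K1: "three ((two ^^ a) F1) = (two ^^ a) ((three ^^ Suc k) F)" for a
    by (simp add: F1_def funpow_commute[of three two, OF three_two])
  have K2: "three ((one ^^ a) F2) = (one ^^ a) ((two ^^ j) ((three ^^ Suc k) F))" for a
    unfolding funpow_commute[of three one, OF three_one] F2_def K1 ..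
  have "eval_monom i j k m (grow F) = of_nat i * 3 *
        (one ^^ (i - 1)) ((two ^^ j) ((three ^^ Suc k) F)) (replicate_mset (Suc m) {}) +
      of_nat j * 2 *
        (one ^^ i) (one ((two ^^ (j - 1)) ((three ^^ Suc k) F))) (replicate_mset m {}) +
      of_nat k * (one ^^ i) ((two ^^ j) (two F1)) (replicate_mset m {})"
    unfolding eval_monom_def 2 funpow_linear[OF one_linear] 3 K1 K2
    by (simp add: grow_replicate_empty)
  then show ?thesis
    by (simp add: eval_monom_def F1_def funpow_swap1 mult_ac)
qed

section \<open>The coefficients\<close>

text \<open>Each application of the recurrence raises \<open>i + j + k\<close> by at most one. The
  bound makes \<open>n - (i + j + k)\<close>, the exponent of \<open>t\<close>, a genuine difference
  wherever the coefficient is nonzero.\<close>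

lemma gamma_nonzero: "gamma n i j k \<noteq> 0 \<Longrightarrow> i + j + k \<le> n"
proof (induction n i j k rule: gamma.induct)
  case (3 n i j k)
  show ?case
  proof (rule ccontr)
    assume *: "\<not> ?case"
    have "k \<noteq> 0 \<Longrightarrow> gamma (Suc n) (i + 1) j (k - 1) = 0"
      using 3(1) * by fastforce
    moreover have "i \<noteq> 0 \<Longrightarrow> k \<noteq> 0 \<Longrightarrow> gamma (Suc n) (i - 1) (j + 1) (k - 1) = 0"
      using 3(2) * by fastforce
    moreover have "j \<noteq> 0 \<Longrightarrow> gamma (Suc n) i (j - 1) k = 0"
      using 3(3) * by fastforce
    ultimately show False using 3(4) by (auto split: if_splits)
  qed
qed (auto split: if_splits)

text \<open>Index shifts with truncated subtraction are bijective only between the supports, which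
  \<open>P\<close> and \<open>R\<close> describe; the terms outside vanish.\<close>

lemma sum_reindex_support:
  assumes "finite S" "finite T"
    and "\<And>a. a \<in> S \<Longrightarrow> \<not> P a \<Longrightarrow> g a = 0" "\<And>b. b \<in> T \<Longrightarrow> \<not> R b \<Longrightarrow> h b = 0"
    and "\<And>a. a \<in> S \<Longrightarrow> P a \<Longrightarrow> \<psi> (\<phi> a) = a \<and> \<phi> a \<in> T \<and> R (\<phi> a) \<and> h (\<phi> a) = g a"
    and "\<And>b. b \<in> T \<Longrightarrow> R b \<Longrightarrow> \<phi> (\<psi> b) = b \<and> \<psi> b \<in> S \<and> P (\<psi> b)"
  shows "sum g S = (sum h T :: 'b::comm_monoid_add)"
proof -
  have "sum g S = sum g {a \<in> S. P a}"
    using assms(1,3) by (intro sum.mono_neutral_right) auto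
  also have "\<dots> = sum h {b \<in> T. R b}"
    using assms(5,6) by (intro sum.reindex_bij_witness[of _ \<psi> \<phi>]) auto
  also have "\<dots> = sum h T"
    using assms(2,4) by (intro sum.mono_neutral_left) auto
  finally show ?thesis .
qed

text \<open>Each of the three terms of the product rule shifts the indices so that
  \<open>i + 2j + 3k\<close> grows by \<open>2\<close>; collecting the coefficients of a monomial
  yields the recurrence of \<open>gamma\<close>.\<close>

lemma gamma_sum_Suc:
  assumes "n \<ge> 1"
  defines "S \<equiv> \<lambda>n. {(i, j, k). i + 2 * j + 3 * k = 2 * n + (1::nat)}"
  shows "(\<Sum>(i, j, k)\<in>S (Suc n). of_int (gamma (Suc n) i j k) * eval_monom i j k (Suc n - (i + j + k)) F) =
    (\<Sum>(i, j, k)\<in>S n. of_int (gamma n i j k) * eval_monom i j k (n - (i + j + k)) (grow F))"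
proof -
  have fin: "finite (S n)" "finite (S (Suc n))"
    unfolding S_def by (rule finite_gamma_indices)+
  let ?E = "\<lambda>i j k. eval_monom i j k (Suc n - (i + j + k)) F"
  let ?g = "\<lambda>i j k. of_int (gamma n i j k)"
  obtain n' where n': "n = Suc n'" using assms by (cases n) auto
  have "(\<Sum>(i, j, k)\<in>S n. of_nat k * ?g i j k * eval_monom i (j + 1) k (n - (i + j + k)) F) =
      (\<Sum>(i, j, k)\<in>S (Suc n). (if j = 0 then 0 else of_nat k * ?g i (j - 1) k) * ?E i j k)"
    by (rule sum_reindex_support[OF fin, where P = "\<lambda>(i, j, k). k \<noteq> 0" and
          R = "\<lambda>(i, j, k). j \<noteq> 0 \<and> k \<noteq> 0" and \<phi> = "\<lambda>(i, j, k). (i, j + 1, k)" and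
          \<psi> = "\<lambda>(i, j, k). (i, j - 1, k)"]) (auto simp: S_def intro: gr0I split: if_splits)
  moreover
  have "(\<Sum>(i, j, k)\<in>S n. 2 * of_nat j * ?g i j k * eval_monom (i + 1) (j - 1) (k + 1) (n - (i + j + k)) F) =
      (\<Sum>(i, j, k)\<in>S (Suc n). (if i = 0 \<or> k = 0 then 0
        else 2 * of_nat (j + 1) * ?g (i - 1) (j + 1) (k - 1)) * ?E i j k)"
    by (rule sum_reindex_support[OF fin, where P = "\<lambda>(i, j, k). j \<noteq> 0" and
          R = "\<lambda>(i, j, k). i \<noteq> 0 \<and> k \<noteq> 0" and \<phi> = "\<lambda>(i, j, k). (i + 1, j - 1, k + 1)" and
          \<psi> = "\<lambda>(i, j, k). (i - 1, j + 1, k - 1)"]) (auto simp: S_def intro: gr0I split: if_splits)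
  moreover
  have "(\<Sum>(i, j, k)\<in>S n. 3 * of_nat i * ?g i j k * eval_monom (i - 1) j (k + 1) (n - (i + j + k) + 1) F) =
      (\<Sum>(i, j, k)\<in>S (Suc n). (if k = 0 then 0
        else 3 * of_nat (i + 1) * ?g (i + 1) j (k - 1)) * ?E i j k)"
  proof (rule sum_reindex_support[OF fin, where P = "\<lambda>(i, j, k). i \<noteq> 0" and
          R = "\<lambda>(i, j, k). k \<noteq> 0" and \<phi> = "\<lambda>(i, j, k). (i - 1, j, k + 1)" and
          \<psi> = "\<lambda>(i, j, k). (i + 1, j, k - 1)"], goal_cases)
    case (3 a)
    obtain i j k where a: "a = (i, j, k)" by (cases a) auto
    \<comment> \<open>Only for this shift does the exponent of \<open>t\<close> really change, so
      truncation must be excluded; the other two shifts raise \<open>n\<close> and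
      \<open>i + j + k\<close> together.\<close>
    have "gamma n i j k = 0 \<or> Suc n - (i + j + k) = Suc (n - (i + j + k))"
      using gamma_nonzero[of n i j k] by (metis Suc_diff_le)
    then show ?case using 3 by (auto simp: S_def a)
  qed (auto simp: S_def intro: gr0I split: if_splits)
  moreover have "of_int (gamma (Suc n) i j k) * ?E i j k =
      (if j = 0 then 0 else of_nat k * ?g i (j - 1) k) * ?E i j k +
      (if i = 0 \<or> k = 0 then 0 else 2 * of_nat (j + 1) * ?g (i - 1) (j + 1) (k - 1)) * ?E i j k +
      (if k = 0 then 0 else 3 * of_nat (i + 1) * ?g (i + 1) j (k - 1)) * ?E i j k" for i j k
    unfolding n' gamma.simps by (simp add: algebra_simps)
  moreover have "?g i j k * eval_monom i j k (n - (i + j + k)) (grow F) =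
      of_nat k * ?g i j k * eval_monom i (j + 1) k (n - (i + j + k)) F +
      2 * of_nat j * ?g i j k * eval_monom (i + 1) (j - 1) (k + 1) (n - (i + j + k)) F +
      3 * of_nat i * ?g i j k * eval_monom (i - 1) j (k + 1) (n - (i + j + k) + 1) F" for i j k
    unfolding eval_monom_grow by (simp add: algebra_simps)
  ultimately show ?thesis
    by (simp only: case_prod_unfold sum.distrib)
qed

lemma sum_profile_eq_gamma_sum:
  assumes "n \<ge> 1"
  shows "(\<Sum>w\<in>stirling_perms n. F (profile n w)) =
    (\<Sum>(i, j, k) \<in> {(i, j, k). i + 2 * j + 3 * k = 2 * n + 1}.
      of_int (gamma n i j k) * eval_monom i j k (n - (i + j + k)) F)"
  using assms
\<comment> \<open>The functional stays arbitrary because the induction hypothesis is applied to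
  \<open>grow F\<close>. The start is the single monomial \<open>K\<close>.\<close>
proof (induction n arbitrary: F rule: nat_induct_at_least)
  case base
  have "(\<Sum>(i, j, k) \<in> {(i, j, k). i + 2 * j + 3 * k = 2 * 1 + (1::nat)}.
      of_int (gamma 1 i j k) * eval_monom i j k (1 - (i + j + k)) F) =
    (\<Sum>(i, j, k) \<in> {(0, 0, 1)}. of_int (gamma 1 i j k) * eval_monom i j k (1 - (i + j + k)) F)"
    by (rule sum.mono_neutral_right[OF finite_gamma_indices]) (auto split: if_splits)
  then show ?case
    unfolding sum_profile_1 by (simp add: eval_monom_def three_def)
next
  case (Suc n)
  then show ?case
    by (simp only: sum_profile_Suc[OF Suc.hyps] Suc.IH gamma_sum_Suc[OF Suc.hyps])
qed

section \<open>Evaluation at weights\<close>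

lemma funpow_eigen:
  fixes f :: "('b \<Rightarrow> 'a::comm_ring_1) \<Rightarrow> 'b \<Rightarrow> 'a"
  assumes "\<And>c. f (\<lambda>m. c * F m) = (\<lambda>m. c * d * F m)"
  shows "(f ^^ i) (\<lambda>m. c * F m) = (\<lambda>m. c * d ^ i * F m)"
proof (induction i)
  case (Suc i)
  have "(f ^^ Suc i) (\<lambda>m. c * F m) = f (\<lambda>m. (c * d ^ i) * F m)" by (simp add: Suc.IH)
  also have "\<dots> = (\<lambda>m. c * d ^ Suc i * F m)" unfolding assms by (simp add: mult_ac)
  finally show ?case .
qed simp

text \<open>A multiplicative functional is a common eigenvector of \<open>one\<close>,
  \<open>two\<close> and \<open>three\<close>; the eigenvalues are the values of \<open>I\<close>,
  \<open>J\<close> and \<open>K\<close> at the weights.\<close>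

lemma eval_monom_prod_mset:
  fixes wt :: "kind set \<Rightarrow> 'a::comm_ring_1"
  shows "eval_monom i j k m (\<lambda>m. \<Prod>T\<in>#m. wt T) =
    (\<Sum>b\<in>UNIV. wt {b}) ^ i * (\<Sum>b\<in>UNIV. wt (- {b})) ^ j * wt UNIV ^ k * wt {} ^ m"
proof -
  let ?F = "\<lambda>m. \<Prod>T\<in>#m. wt T"
  have "three (\<lambda>m. c * ?F m) = (\<lambda>m. c * wt UNIV * ?F m)" for c
    by (rule ext) (simp add: three_def mult_ac)
  note 3 = funpow_eigen[of three, OF this]
  have "two (\<lambda>m. c * ?F m) = (\<lambda>m. c * (\<Sum>b\<in>UNIV. wt (- {b})) * ?F m)" for c
    by (rule ext) (simp add: two_def sum_UNIV_kind algebra_simps)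
  note 2 = funpow_eigen[of two, OF this]
  have "one (\<lambda>m. c * ?F m) = (\<lambda>m. c * (\<Sum>b\<in>UNIV. wt {b}) * ?F m)" for c
    by (rule ext) (simp add: one_def sum_UNIV_kind algebra_simps)
  note 1 = funpow_eigen[of one, OF this]
  have "eval_monom i j k m (\<lambda>m. 1 * ?F m) =
    (\<Sum>b\<in>UNIV. wt {b}) ^ i * (\<Sum>b\<in>UNIV. wt (- {b})) ^ j * wt UNIV ^ k * wt {} ^ m"
    unfolding eval_monom_def 3 2 1 by (simp add: mult_ac)
  then show ?thesis by simp
qed

section \<open>The statistics\<close>

lemma stirling_permsD:
  assumes "w \<in> stirling_perms n" "1 \<le> i" "i < k" "k < j" "j \<le> 2 * n" "letter w i = letter w j"
  shows "letter w i < letter w k"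
  using assms unfolding stirling_perms_def by blast

lemma stirling_perms_positions:
  assumes w: "w \<in> stirling_perms n" and v: "v \<in> {1..n}"
  obtains i j where "i < j" "i \<in> {1..2*n}" "j \<in> {1..2*n}"
    "\<And>l. letter w l = v \<longleftrightarrow> l = i \<or> l = j" "\<And>l. i < l \<Longrightarrow> l < j \<Longrightarrow> v < letter w l"
proof -
  have len: "length w = 2 * n" using length_stirling_perms[OF w] .
  have m: "mset w = mset_set {1..n} + mset_set {1..n}" using w by (simp add: stirling_perms_def)
  have "count (mset w) v = 2" unfolding m using v by simp
  then have "card {l. l < length w \<and> w ! l = v} = 2"
    using length_filter_conv_card[of "(=) v" w]
    by (auto simp: count_mset count_list_eq_length_filter elim!: back_subst[of "\<lambda>A. card A = 2"])
  then obtain c d where cd: "{l. l < length w \<and> w ! l = v} = {c, d}" "c \<noteq> d"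
    by (auto simp: card_2_iff)
  \<comment> \<open>List indices start at \<open>0\<close>, so the positions sought are
    \<open>Suc a\<close> and \<open>Suc b\<close>.\<close>
  define a b where "a = min c d" and "b = max c d"
  have ab: "{l. l < length w \<and> w ! l = v} = {a, b}" "a < b"
    using cd(2) unfolding cd(1) a_def b_def by (auto simp: min_def max_def)
  have lt: "a < 2 * n" "b < 2 * n"
  proof -
    have "a \<in> {l. l < length w \<and> w ! l = v}" "b \<in> {l. l < length w \<and> w ! l = v}"
      unfolding ab(1) by simp_all
    then show "a < 2 * n" "b < 2 * n" using len by simp_all
  qed
  \<comment> \<open>Outside the word \<open>letter\<close> is \<open>0\<close>, which differs from
    \<open>v\<close>, so no border position qualifies.\<close>
  have pos: "letter w l = v \<longleftrightarrow> l = Suc a \<or> l = Suc b" for l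
  proof -
    have "letter w l = v \<longleftrightarrow> 1 \<le> l \<and> l - 1 \<in> {l. l < length w \<and> w ! l = v}"
      using v by (auto simp: letter_def)
    then show ?thesis unfolding ab(1) by auto
  qed
  have "v < letter w l" if "Suc a < l" "l < Suc b" for l
  proof -
    have "letter w (Suc a) = v" "letter w (Suc b) = v" using pos by auto
    then show ?thesis
      using stirling_permsD[OF w, of "Suc a" l "Suc b"] that lt by simp
  qed
  then show thesis using that[of "Suc a" "Suc b"] ab(2) lt pos by auto
qed

lemma eq_step_iff:
  "(v, b) = step a c \<longleftrightarrow> b = Rise \<and> a < c \<and> v = c \<or> b = Level \<and> a = c \<and> v = a \<or>
    b = Fall \<and> c < a \<and> v = a"
  by (cases b) auto

text \<open>The inner neighbours of the two occurrences are at least \<open>v\<close>, so a rise to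
  \<open>v\<close> can only enter the first occurrence and a fall from \<open>v\<close> can only
  leave the second.\<close>

lemma steps_of_iff:
  assumes w: "w \<in> stirling_perms n" and v: "v \<in> {1..n}"
    and ij: "i < j" "i \<in> {1..2*n}" "j \<in> {1..2*n}"
    and pos: "\<And>l. letter w l = v \<longleftrightarrow> l = i \<or> l = j"
    and between: "\<And>l. i < l \<Longrightarrow> l < j \<Longrightarrow> v < letter w l"
  shows "Rise \<in> steps_of w v \<longleftrightarrow> letter w (i - 1) < v"
    and "Level \<in> steps_of w v \<longleftrightarrow> j = i + 1"
    and "Fall \<in> steps_of w v \<longleftrightarrow> letter w (j + 1) < v"
proof -
  note len = length_stirling_perms[OF w]
  have before: "\<not> letter w (j - 1) < v"
  proof (cases "j - 1 = i")
    case False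
    then have "i < j - 1" "j - 1 < j" using ij by linarith+
    then show ?thesis using between[of "j - 1"] by simp
  qed (use pos[of i] in simp)
  have after: "\<not> letter w (i + 1) < v"
  proof (cases "i + 1 = j")
    case False
    then have "i < i + 1" "i + 1 < j" using ij by linarith+
    then show ?thesis using between[of "i + 1"] by simp
  qed (use pos[of j] in simp)
  have "Rise \<in> steps_of w v \<longleftrightarrow> (\<exists>g\<le>2 * n. letter w g < letter w (Suc g) \<and> v = letter w (Suc g))"
    unfolding steps_of_def mem_Collect_eq in_set_steps eq_step_iff len by auto
  also have "\<dots> \<longleftrightarrow> (\<exists>g\<le>2 * n. letter w g < v \<and> (Suc g = i \<or> Suc g = j))"
    unfolding pos[symmetric] by auto
  also have "\<dots> \<longleftrightarrow> letter w (i - 1) < v"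
    using before ij by (auto intro!: exI[of _ "i - 1"])
  finally show "Rise \<in> steps_of w v \<longleftrightarrow> letter w (i - 1) < v" .
  have "Level \<in> steps_of w v \<longleftrightarrow> (\<exists>g\<le>2 * n. letter w g = v \<and> letter w (Suc g) = v)"
    unfolding steps_of_def mem_Collect_eq in_set_steps eq_step_iff len by auto
  also have "\<dots> \<longleftrightarrow> j = i + 1"
    unfolding pos using ij by (auto intro!: exI[of _ i])
  finally show "Level \<in> steps_of w v \<longleftrightarrow> j = i + 1" .
  have "Fall \<in> steps_of w v \<longleftrightarrow> (\<exists>g\<le>2 * n. letter w g > letter w (Suc g) \<and> letter w g = v)"
    unfolding steps_of_def mem_Collect_eq in_set_steps eq_step_iff len by auto
  also have "\<dots> \<longleftrightarrow> (\<exists>g\<le>2 * n. letter w (Suc g) < v \<and> (g = i \<or> g = j))"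
    unfolding pos[symmetric] by auto
  also have "\<dots> \<longleftrightarrow> letter w (j + 1) < v"
    using after ij by auto
  finally show "Fall \<in> steps_of w v \<longleftrightarrow> letter w (j + 1) < v" .
qed

lemma statistics_steps_of:
  assumes w: "w \<in> stirling_perms n"
  shows "asc n w = card {v \<in> {1..n}. Rise \<in> steps_of w v}"
    and "plat n w = card {v \<in> {1..n}. Level \<in> steps_of w v}"
    and "des n w = card {v \<in> {1..n}. Fall \<in> steps_of w v}"
    and "lap n w = card {v \<in> {1..n}. {Rise, Level} \<subseteq> steps_of w v}"
    and "rpd n w = card {v \<in> {1..n}. {Level, Fall} \<subseteq> steps_of w v}"
    and "eud n w = card {v \<in> {1..n}. {Rise, Fall} \<subseteq> steps_of w v}"
    and "apd n w = card {v \<in> {1..n}. steps_of w v = UNIV}"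
    and "vv n w = card {v \<in> {1..n}. steps_of w v = {}}"
proof -
  have *: "((\<exists>i\<in>{1..2*n}. v = letter w i \<and> letter w (i - 1) < letter w i) \<longleftrightarrow> Rise \<in> steps_of w v) \<and>
    ((\<exists>i\<in>{1..2*n}. v = letter w i \<and> letter w i = letter w (i + 1)) \<longleftrightarrow> Level \<in> steps_of w v) \<and>
    ((\<exists>i\<in>{1..2*n}. v = letter w i \<and> letter w i > letter w (i + 1)) \<longleftrightarrow> Fall \<in> steps_of w v) \<and>
    ((\<exists>i\<in>{1..2*n}. v = letter w i \<and> letter w (i - 1) < letter w i \<and> letter w i = letter w (i + 1))
      \<longleftrightarrow> {Rise, Level} \<subseteq> steps_of w v) \<and>
    ((\<exists>i\<in>{1..2*n}. v = letter w i \<and> letter w (i - 1) = letter w i \<and> letter w i > letter w (i + 1))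
      \<longleftrightarrow> {Level, Fall} \<subseteq> steps_of w v) \<and>
    ((\<exists>i\<in>{1..2*n}. \<exists>j\<in>{1..2*n}. i < j \<and> v = letter w i \<and> v = letter w j \<and>
       letter w (i - 1) < letter w i \<and> letter w j > letter w (j + 1))
      \<longleftrightarrow> {Rise, Fall} \<subseteq> steps_of w v) \<and>
    ((\<exists>i\<in>{1..2*n}. v = letter w i \<and> letter w (i - 1) < letter w i \<and> letter w i = letter w (i + 1) \<and>
       letter w (i + 1) > letter w (i + 2)) \<longleftrightarrow> steps_of w v = UNIV) \<and>
    ((\<exists>i\<in>{1..2*n}. \<exists>j\<in>{1..2*n}. i < j \<and> v = letter w i \<and> v = letter w j \<and>
       valley w i \<and> valley w j) \<longleftrightarrow> steps_of w v = {})"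
    if v: "v \<in> {1..n}" for v
  proof -
    obtain i j where ij: "i < j" "i \<in> {1..2*n}" "j \<in> {1..2*n}"
      and pos: "\<And>l. letter w l = v \<longleftrightarrow> l = i \<or> l = j"
      and between: "\<And>l. i < l \<Longrightarrow> l < j \<Longrightarrow> v < letter w l"
      using stirling_perms_positions[OF w v] by blast
    have st: "Rise \<in> steps_of w v \<longleftrightarrow> letter w (i - 1) < v" "Level \<in> steps_of w v \<longleftrightarrow> j = i + 1"
      "Fall \<in> steps_of w v \<longleftrightarrow> letter w (j + 1) < v"
      by (rule steps_of_iff[OF w v ij pos between]; assumption)+
    have before: "letter w (j - 1) > v \<longleftrightarrow> j \<noteq> i + 1" "\<not> letter w (j - 1) < v"
    proof -
      show "letter w (j - 1) > v \<longleftrightarrow> j \<noteq> i + 1"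
      proof (cases "j - 1 = i")
        case False
        then have "i < j - 1" "j - 1 < j" using ij by linarith+
        then show ?thesis using between[of "j - 1"] by simp
      qed (use pos[of i] ij in simp)
      then show "\<not> letter w (j - 1) < v"
        using pos[of i] by (cases "j = i + 1") auto
    qed
    have after: "letter w (i + 1) > v \<longleftrightarrow> j \<noteq> i + 1" "\<not> letter w (i + 1) < v"
    proof -
      show "letter w (i + 1) > v \<longleftrightarrow> j \<noteq> i + 1"
      proof (cases "i + 1 = j")
        case False
        then have "i < i + 1" "i + 1 < j" using ij by linarith+
        then show ?thesis using between[of "i + 1"] by simp
      qed (use pos[of j] ij in simp)
      then show "\<not> letter w (i + 1) < v"
        using pos[of j] by (cases "j = i + 1") auto
    qed
    have li: "letter w i = v" and lj: "letter w j = v" using pos by auto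
    have outer: "letter w (i - 1) \<noteq> v" "letter w (j + 1) \<noteq> v"
      using pos ij by auto
    have pos': "v = letter w l \<longleftrightarrow> l = i \<or> l = j" for l
      using pos by metis
    \<comment> \<open>The quantifiers over positions in the statistics reduce to the two occurrences
      \<open>i\<close> and \<open>j\<close>.\<close>
    have at: "(\<exists>l\<in>{1..2*n}. v = letter w l \<and> P l) \<longleftrightarrow> P i \<or> P j" for P
      unfolding pos' using ij by blast
    have at2: "(\<exists>l\<in>{1..2*n}. \<exists>l'\<in>{1..2*n}. l < l' \<and> v = letter w l \<and> v = letter w l' \<and> P l l')
        \<longleftrightarrow> P i j" for P
      unfolding pos' using ij by (blast dest: less_asym)
    have full: "steps_of w v = UNIV \<longleftrightarrow> {Rise, Level, Fall} \<subseteq> steps_of w v"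
      unfolding UNIV_kind using UNIV_kind by blast
    have empty: "steps_of w v = {} \<longleftrightarrow>
        Rise \<notin> steps_of w v \<and> Level \<notin> steps_of w v \<and> Fall \<notin> steps_of w v"
      by (metis kind.exhaust all_not_in_conv)
    have eqs: "v = letter w (i + 1) \<longleftrightarrow> j = i + 1" "letter w (j - 1) = v \<longleftrightarrow> j = i + 1"
      "v = letter w (j + 1) \<longleftrightarrow> False" "letter w (i - 1) = v \<longleftrightarrow> False"
      using pos[of "i + 1"] pos[of "j - 1"] ij outer by auto
    \<comment> \<open>The outer neighbours differ from \<open>v\<close>, so a missing rise or fall
      means a larger neighbour; this is what turns valleys into missing steps.\<close>
    have gt: "v < letter w (i - 1) \<longleftrightarrow> \<not> letter w (i - 1) < v"
      "v < letter w (j + 1) \<longleftrightarrow> \<not> letter w (j + 1) < v"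
      using outer by linarith+
    have top: "j = i + 1 \<and> letter w (i + 2) < letter w (i + 1) \<longleftrightarrow> j = i + 1 \<and> letter w (j + 1) < v"
      using lj by auto
    show ?thesis
      unfolding at at2 full empty valley_def insert_subset st
      by (simp only: li lj before after eqs gt top empty_subsetI simp_thms) blast
  qed
  have cong: "card {v \<in> {1..n}. P v} = card {v \<in> {1..n}. R v}"
    if "\<And>v. v \<in> {1..n} \<Longrightarrow> P v \<longleftrightarrow> R v" for P R
    using that by (metis (mono_tags, lifting) Collect_cong)
  show "asc n w = card {v \<in> {1..n}. Rise \<in> steps_of w v}"
    "plat n w = card {v \<in> {1..n}. Level \<in> steps_of w v}"
    "des n w = card {v \<in> {1..n}. Fall \<in> steps_of w v}"
    "lap n w = card {v \<in> {1..n}. {Rise, Level} \<subseteq> steps_of w v}"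
    "rpd n w = card {v \<in> {1..n}. {Level, Fall} \<subseteq> steps_of w v}"
    "eud n w = card {v \<in> {1..n}. {Rise, Fall} \<subseteq> steps_of w v}"
    "apd n w = card {v \<in> {1..n}. steps_of w v = UNIV}"
    "vv n w = card {v \<in> {1..n}. steps_of w v = {}}"
    unfolding asc_def plat_def des_def lap_def rpd_def eud_def apd_def vv_def
    by (rule cong, simp only: *)+
qed

section \<open>Weights of step sets and the generating function\<close>

definition weight :: "'a \<Rightarrow> 'a \<Rightarrow> 'a \<Rightarrow> 'a \<Rightarrow> 'a \<Rightarrow> 'a \<Rightarrow> 'a \<Rightarrow> 'a \<Rightarrow> kind set \<Rightarrow> 'a::comm_ring_1" where
  "weight x y z p q r s t T =
    (if Rise \<in> T then x else 1) * (if Level \<in> T then y else 1) * (if Fall \<in> T then z else 1) *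
    (if {Rise, Level} \<subseteq> T then p else 1) * (if {Rise, Fall} \<subseteq> T then q else 1) *
    (if {Level, Fall} \<subseteq> T then r else 1) * (if T = UNIV then s else 1) * (if T = {} then t else 1)"

lemma prod_if_one:
  "finite A \<Longrightarrow> (\<Prod>v\<in>A. if P v then x else 1) = (x::'a::comm_ring_1) ^ card {v \<in> A. P v}"
  by (simp flip: prod.inter_filter)

text \<open>Each conditional factor of \<open>weight\<close>, multiplied over all letters, gives the
  power of its variable counted by the matching statistic.\<close>

lemma Q_poly_profile:
  "Q_poly n x y z p q r s t =
    (\<Sum>w\<in>stirling_perms n. \<Prod>T\<in>#profile n w. weight x y z p q r s t T)"
  unfolding Q_poly_def
proof (rule sum.cong[OF refl])
  fix w assume w: "w \<in> stirling_perms n"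
  have "(\<Prod>T\<in>#profile n w. weight x y z p q r s t T) =
      (\<Prod>v\<in>{1..n}. weight x y z p q r s t (steps_of w v))"
    by (simp add: profile_def prod_unfold_prod_mset image_mset.compositionality comp_def)
  also have "\<dots> = x ^ asc n w * y ^ plat n w * z ^ des n w * p ^ lap n w *
     q ^ eud n w * r ^ rpd n w * s ^ apd n w * t ^ vv n w"
    unfolding weight_def prod.distrib statistics_steps_of[OF w] by (simp only: prod_if_one finite_atLeastAtMost)
  finally show "x ^ asc n w * y ^ plat n w * z ^ des n w * p ^ lap n w *
     q ^ eud n w * r ^ rpd n w * s ^ apd n w * t ^ vv n w =
    (\<Prod>T\<in>#profile n w. weight x y z p q r s t T)" ..
qed

theorem theorem4:
  fixes n :: nat and x y z p q r s t :: "'a::field"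
  assumes "n \<ge> 1" and "t \<noteq> 0"
  shows "Q_poly n x y z p q r s t =
    t ^ n * (\<Sum>(i, j, k) \<in> {(i, j, k). i + 2 * j + 3 * k = 2 * n + 1}.
      of_int (gamma n i j k) *
      ((x + y + z) / t) ^ i *
      ((x * y * p + x * z * q + y * z * r) / t) ^ j *
      ((x * y * z * p * q * r * s) / t) ^ k)"
proof -
  let ?wt = "weight x y z p q r s t"
  have compl: "- {Rise} = {Level, Fall}" "- {Level} = {Rise, Fall}" "- {Fall} = {Rise, Level}"
    using UNIV_kind by auto
  \<comment> \<open>This keeps the factor \<open>s\<close> out of the weights of singletons and
    two-element sets.\<close>
  have proper: "{b} \<noteq> UNIV" "- {b} \<noteq> UNIV" for b :: kind
    by (cases b; auto simp: UNIV_kind)+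
  have 1: "(\<Sum>b\<in>UNIV. ?wt {b}) = x + y + z"
    using proper(1) by (simp add: sum_UNIV_kind weight_def)
  have 2: "(\<Sum>b\<in>UNIV. ?wt (- {b})) = x * y * p + x * z * q + y * z * r"
    using proper(2)[of Rise] proper(2)[of Level] proper(2)[of Fall]
    by (simp add: sum_UNIV_kind weight_def compl algebra_simps)
  have 3: "?wt UNIV = x * y * z * p * q * r * s" and 0: "?wt {} = t"
    by (simp_all add: weight_def)
  have "Q_poly n x y z p q r s t = (\<Sum>(i, j, k) \<in> {(i, j, k). i + 2 * j + 3 * k = 2 * n + 1}.
      of_int (gamma n i j k) * eval_monom i j k (n - (i + j + k)) (\<lambda>m. \<Prod>T\<in>#m. ?wt T))"
    unfolding Q_poly_profile by (rule sum_profile_eq_gamma_sum[OF assms(1)])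
  also have "\<dots> = (\<Sum>(i, j, k) \<in> {(i, j, k). i + 2 * j + 3 * k = 2 * n + 1}. t ^ n *
      (of_int (gamma n i j k) *
      ((x + y + z) / t) ^ i *
      ((x * y * p + x * z * q + y * z * r) / t) ^ j *
      ((x * y * z * p * q * r * s) / t) ^ k))"
  proof (rule sum.cong[OF refl], clarify)
    fix i j k
    show "of_int (gamma n i j k) * eval_monom i j k (n - (i + j + k)) (\<lambda>m. \<Prod>T\<in>#m. ?wt T) =
      t ^ n * (of_int (gamma n i j k) *
      ((x + y + z) / t) ^ i *
      ((x * y * p + x * z * q + y * z * r) / t) ^ j *
      ((x * y * z * p * q * r * s) / t) ^ k)"
    proof (cases "gamma n i j k = 0")
      case False
      \<comment> \<open>The nonzero coefficient gives \<open>i + j + k \<le> n\<close>, so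
        \<open>t ^ n\<close> cancels all denominators and leaves the weight of the letters without
        steps.\<close>
      then have "t ^ n = t ^ (n - (i + j + k)) * t ^ i * t ^ j * t ^ k"
        using gamma_nonzero[of n i j k] by (simp flip: power_add)
      then show ?thesis
        using assms(2) unfolding eval_monom_prod_mset 1 2 3 0
        by (simp add: power_divide mult_ac)
    qed simp
  qed
  finally show ?thesis
    by (simp add: sum_distrib_left case_prod_unfold)
qed

end
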